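(* Let $p(x,y)$ be a joint probability density of $(X,Y)$, let $q_\phi(z\mid x)$ be an encoder (conditional density) with parameter $\phi$, and let $p_\phi(x,z)$, $p_\phi(y,z)$, $p_\phi(z)$ be the induced densities described in the context. Let $\beta\ge 0$. Let $q,r$ range over probability densities on the $x$- and $z$-spaces with $p_\phi(x,z)\ll q(x)r(z)$, and let $q',r'$ range over probability densities on the $y$- and $z$-spaces with $p_\phi(y,z)\ll q'(y)r'(z)$, where all Kullback--Leibler terms below are assumed finite. Then: (1) For all such $q,r$, $$\mathrm{KL}\big(p_\phi(x,z)\,\|\,q(x)r(z)\big)=\mathrm{KL}\big(p_\phi(x,z)\,\|\,p(x)p_\phi(z)\big)+\mathrm{KL}\big(p(x)p_\phi(z)\,\|\,q(x)r(z)\big),$$ where the first term on the right equals $I_\phi(X;Z)$ and the second is $\ge 0$. Consequently $$I_\phi(Z;X)=\min_{q,r}\mathrm{KL}\big(p_\phi(x,z)\,\|\,q(x)r(z)\big),$$ with minimizer $(q,r)=(p(x),p_\phi(z))$. (2) For all such $q',r'$, $$\mathrm{KL}\big(p_\phi(y,z)\,\|\,q'(y)r'(z)\big)=I_\phi(Z;Y)+\mathrm{KL}\big(p(y)p_\phi(z)\,\|\,q'(y)r'(z)\big),$$ and consequently $I_\phi(Z;Y)=\min_{q',r'}\mathrm{KL}\big(p_\phi(y,z)\,\|\,q'(y)r'(z)\big)$, with minimizer $(q',r')=(p(y),p_\phi(z))$. (3) The Information Bottleneck loss $\mathcal L_{\mathrm{IB}}(\phi)=\beta\,I_\phi(Z;X)-I_\phi(Z;Y)$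 satisfies $$\mathcal L_{\mathrm{IB}}(\phi)=\beta\min_{q,r}\mathrm{KL}\big(p_\phi(x,z)\,\|\,q(x)r(z)\big)-\min_{q',r'}\mathrm{KL}\big(p_\phi(y,z)\,\|\,q'(y)r'(z)\big).$$
   Context: The representation $Z$ is generated from $X$ by the encoder, so $p_\phi(x,z)=p(x)\,q_\phi(z\mid x)$, $p_\phi(y,z)=\int p(x,y)\,q_\phi(z\mid x)\,dx$, and $p_\phi(z)=\int p(x)\,q_\phi(z\mid x)\,dx$, where $p(x)$ and $p(y)$ are the marginals of $p(x,y)$. $\mathrm{KL}(a\|b)=\int a\log(a/b)$ is the Kullback--Leibler divergence, and $I_\phi(X;Z)=I_\phi(Z;X)=\mathrm{KL}(p_\phi(x,z)\|p(x)p_\phi(z))$, $I_\phi(Z;Y)=\mathrm{KL}(p_\phi(y,z)\|p(y)p_\phi(z))$ are the mutual informations. $\ll$ denotes absolute continuity. Standing assumption: absolute continuity holds as stated, all KL terms are finite, and Fubini's theorem applies to the integrals involved. *)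

theory Defs
  imports "HOL-Probability.Probability"
begin

text \<open>Densities are real-valued and taken with respect to arbitrary reference measures
  (Lebesgue measure in the most common reading of the integrals $\int \ldots\,dx$).\<close>

definition prob_density :: "'a measure \<Rightarrow> ('a \<Rightarrow> real) \<Rightarrow> bool" where
  "prob_density M f \<longleftrightarrow>
     f \<in> borel_measurable M \<and> (\<forall>x\<in>space M. 0 \<le> f x) \<and> (\<integral>\<^sup>+ x. ennreal (f x) \<partial>M) = 1"

definition cond_density :: "'a measure \<Rightarrow> 'b measure \<Rightarrow> ('a \<Rightarrow> 'b \<Rightarrow> real) \<Rightarrow> bool" where
  "cond_density M N k \<longleftrightarrow>
     (\<lambda>(x, z). k x z) \<in> borel_measurable (M \<Otimes>\<^sub>M N) \<and> (\<forall>x\<in>space M. prob_density N (k x))"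

definition prod_density :: "('a \<Rightarrow> real) \<Rightarrow> ('b \<Rightarrow> real) \<Rightarrow> 'a \<times> 'b \<Rightarrow> real" where
  "prod_density f g = (\<lambda>(x, z). f x * g z)"

text \<open>The library writes the reference measure first: \<^term>\<open>KL_divergence b Q P\<close> is
  $\mathrm{KL}(P\,\|\,Q)$, and \<^term>\<open>absolutely_continuous Q P\<close> is $P \ll Q$.
  The base $b$ of the logarithm is left arbitrary.\<close>

definition abs_cont :: "'a measure \<Rightarrow> ('a \<Rightarrow> real) \<Rightarrow> ('a \<Rightarrow> real) \<Rightarrow> bool" where
  "abs_cont M f g \<longleftrightarrow> absolutely_continuous (density M g) (density M f)"

definition KL :: "real \<Rightarrow> 'a measure \<Rightarrow> ('a \<Rightarrow> real) \<Rightarrow> ('a \<Rightarrow> real) \<Rightarrow> real" where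
  "KL b M f g = KL_divergence b (density M g) (density M f)"

text \<open>Since \<^const>\<open>KL_divergence\<close> is a Bochner integral, with value 0 for a non-integrable
  integrand, finiteness of the divergence has to be expressed by integrability. For probability
  densities with $f \ll g$ the negative part of the integrand is always integrable, so that this is
  the same as the divergence being less than $\infty$.\<close>

definition KL_finite :: "real \<Rightarrow> 'a measure \<Rightarrow> ('a \<Rightarrow> real) \<Rightarrow> ('a \<Rightarrow> real) \<Rightarrow> bool" where
  "KL_finite b M f g \<longleftrightarrow>
     integrable (density M f) (entropy_density b (density M g) (density M f))"

lemma abs_cont_iff:
  assumes "prob_density M f" "prob_density M g"
  shows "abs_cont M f g \<longleftrightarrow> (AE x in M. g x = 0 \<longrightarrow> f x = 0)"
proof -
  have [measurable]: "f \<in> borel_measurable M" "g \<in> borel_measurable M"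
    and nn: "\<And>x. x \<in> space M \<Longrightarrow> 0 \<le> f x" "\<And>x. x \<in> space M \<Longrightarrow> 0 \<le> g x"
    using assms by (auto simp: prob_density_def)
  show ?thesis
  proof
    assume "abs_cont M f g"
    moreover have "AE x in density M g. g x \<noteq> 0"
      by (subst AE_density) auto
    ultimately have "AE x in density M f. g x \<noteq> 0"
      unfolding abs_cont_def
      by (intro absolutely_continuous_AE[where M="density M g" and M'="density M f"]) auto
    then have "AE x in M. 0 < f x \<longrightarrow> g x \<noteq> 0"
      by (subst (asm) AE_density) auto
    with AE_space show "AE x in M. g x = 0 \<longrightarrow> f x = 0"
      by eventually_elim (use nn in force)
  next
    assume *: "AE x in M. g x = 0 \<longrightarrow> f x = 0"
    show "abs_cont M f g"
      unfolding abs_cont_def absolutely_continuous_def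
    proof
      fix A assume "A \<in> null_sets (density M (\<lambda>x. ennreal (g x)))"
      then have A: "A \<in> sets M" "AE x in M. x \<in> A \<longrightarrow> ennreal (g x) = 0"
        by (auto simp: null_sets_density_iff)
      have "AE x in M. x \<in> A \<longrightarrow> ennreal (f x) = 0"
        using A(2) * AE_space
      proof eventually_elim
        case (elim x)
        then show ?case using nn(2)[of x] by (auto simp: ennreal_eq_0_iff)
      qed
      with A(1) show "A \<in> null_sets (density M (\<lambda>x. ennreal (f x)))"
        by (auto simp: null_sets_density_iff)
    qed
  qed
qed

lemma (in sigma_finite_measure) KL_eq_integral:
  assumes "1 < b" "prob_density M f" "prob_density M g" "abs_cont M f g"
  shows "KL b M f g = (\<integral>x. f x * log b (f x / g x) \<partial>M)"
  using assms abs_cont_iff[OF assms(2,3)] unfolding KL_def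
  by (intro KL_density_density) (auto simp: prob_density_def)

text \<open>The densities induced by a joint density \<open>p\<close> of $(X,Y)$ and an encoder \<open>e\<close>,
  where \<^term>\<open>e x z\<close> stands for $q_\phi(z \mid x)$.\<close>

definition density_x :: "'y measure \<Rightarrow> ('x \<times> 'y \<Rightarrow> real) \<Rightarrow> 'x \<Rightarrow> real" where
  "density_x MY p = (\<lambda>x. \<integral>y. p (x, y) \<partial>MY)"

definition density_y :: "'x measure \<Rightarrow> ('x \<times> 'y \<Rightarrow> real) \<Rightarrow> 'y \<Rightarrow> real" where
  "density_y MX p = (\<lambda>y. \<integral>x. p (x, y) \<partial>MX)"

definition density_xz ::
    "'y measure \<Rightarrow> ('x \<times> 'y \<Rightarrow> real) \<Rightarrow> ('x \<Rightarrow> 'z \<Rightarrow> real) \<Rightarrow> 'x \<times> 'z \<Rightarrow> real" where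
  "density_xz MY p e = (\<lambda>(x, z). density_x MY p x * e x z)"

definition density_yz ::
    "'x measure \<Rightarrow> ('x \<times> 'y \<Rightarrow> real) \<Rightarrow> ('x \<Rightarrow> 'z \<Rightarrow> real) \<Rightarrow> 'y \<times> 'z \<Rightarrow> real" where
  "density_yz MX p e = (\<lambda>(y, z). \<integral>x. p (x, y) * e x z \<partial>MX)"

definition density_z ::
    "'x measure \<Rightarrow> 'y measure \<Rightarrow> ('x \<times> 'y \<Rightarrow> real) \<Rightarrow> ('x \<Rightarrow> 'z \<Rightarrow> real) \<Rightarrow> 'z \<Rightarrow> real" where
  "density_z MX MY p e = (\<lambda>z. \<integral>x. density_x MY p x * e x z \<partial>MX)"

definition I_ZX :: "real \<Rightarrow> 'x measure \<Rightarrow> 'y measure \<Rightarrow> 'z measure \<Rightarrow>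
    ('x \<times> 'y \<Rightarrow> real) \<Rightarrow> ('x \<Rightarrow> 'z \<Rightarrow> real) \<Rightarrow> real" where
  "I_ZX b MX MY MZ p e =
     KL b (MX \<Otimes>\<^sub>M MZ) (density_xz MY p e) (prod_density (density_x MY p) (density_z MX MY p e))"

definition I_ZY :: "real \<Rightarrow> 'x measure \<Rightarrow> 'y measure \<Rightarrow> 'z measure \<Rightarrow>
    ('x \<times> 'y \<Rightarrow> real) \<Rightarrow> ('x \<Rightarrow> 'z \<Rightarrow> real) \<Rightarrow> real" where
  "I_ZY b MX MY MZ p e =
     KL b (MY \<Otimes>\<^sub>M MZ) (density_yz MX p e) (prod_density (density_y MX p) (density_z MX MY p e))"

definition IB_loss :: "real \<Rightarrow> real \<Rightarrow> 'x measure \<Rightarrow> 'y measure \<Rightarrow> 'z measure \<Rightarrow>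
    ('x \<times> 'y \<Rightarrow> real) \<Rightarrow> ('x \<Rightarrow> 'z \<Rightarrow> real) \<Rightarrow> real" where
  "IB_loss b \<beta> MX MY MZ p e = \<beta> * I_ZX b MX MY MZ p e - I_ZY b MX MY MZ p e"

definition admissible :: "real \<Rightarrow> 'a measure \<Rightarrow> 'b measure \<Rightarrow> ('a \<times> 'b \<Rightarrow> real) \<Rightarrow>
    ('a \<Rightarrow> real) \<Rightarrow> ('b \<Rightarrow> real) \<Rightarrow> bool" where
  "admissible b M N p q r \<longleftrightarrow>
     prob_density M q \<and> prob_density N r \<and>
     abs_cont (M \<Otimes>\<^sub>M N) p (prod_density q r) \<and>
     KL_finite b (M \<Otimes>\<^sub>M N) p (prod_density q r)"

text \<open>\<^const>\<open>Least\<close> rather than \<^const>\<open>Inf\<close>, because a minimum is meant.\<close>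

definition min_KL :: "real \<Rightarrow> 'a measure \<Rightarrow> 'b measure \<Rightarrow> ('a \<times> 'b \<Rightarrow> real) \<Rightarrow> real" where
  "min_KL b M N p =
     (LEAST v. \<exists>q r. admissible b M N p q r \<and> v = KL b (M \<Otimes>\<^sub>M N) p (prod_density q r))"

end

theory Submission
  imports Defs
begin

text \<open>Let \<open>f\<close> be a joint density with marginals \<open>f1\<close>, \<open>f2\<close>. Pointwise,
  $\log\frac{f}{qr} = \log\frac{f}{f_1 f_2} + \log\frac{f_1}{q} + \log\frac{f_2}{r}$, and the last
  two terms depend on one coordinate each, so their integrals against $f$ and against $f_1 f_2$
  coincide. The negative parts of these two terms are integrable, hence finiteness of the left-hand
  side forces each of them to be integrable on its own; Gibbs' inequality for $(f_1, q)$ and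
  $(f_2, r)$ then gives minimality over all admissible pairs, for which
  $\mathrm{KL}(f_1 f_2 \,\|\, q r) < \infty$ is a consequence.\<close>

section \<open>Divergence and absolute continuity expressed through pointwise ratios of
  densities\<close>

lemma prob_densityD:
  assumes "prob_density M f"
  shows prob_density_measurable: "f \<in> borel_measurable M"
    and prob_density_nonneg: "\<And>x. x \<in> space M \<Longrightarrow> 0 \<le> f x"
    and prob_density_nn_integral: "(\<integral>\<^sup>+ x. ennreal (f x) \<partial>M) = 1"
  using assms by (auto simp: prob_density_def)

lemma prob_density_AE_nonneg: "prob_density M f \<Longrightarrow> AE x in M. 0 \<le> f x"
  by (auto simp: prob_density_def)

lemma prob_density_integrable:
  assumes "prob_density M f"
  shows "integrable M f"
  using prob_densityD[OF assms] prob_density_AE_nonneg[OF assms] by (intro integrableI_nonneg) auto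

lemma prob_space_density_prob_density:
  assumes "prob_density M f"
  shows "prob_space (density M f)"
  using prob_densityD[OF assms]
  by (intro prob_spaceI) (simp add: emeasure_density cong: nn_integral_cong)

lemma AE_density_prob_density:
  assumes "prob_density M f"
  shows "(AE x in density M f. P x) \<longleftrightarrow> (AE x in M. f x \<noteq> 0 \<longrightarrow> P x)"
proof -
  have "(AE x in density M f. P x) \<longleftrightarrow> (AE x in M. 0 < f x \<longrightarrow> P x)"
    using prob_density_measurable[OF assms] by (subst AE_density) auto
  also have "\<dots> \<longleftrightarrow> (AE x in M. f x \<noteq> 0 \<longrightarrow> P x)"
    using prob_density_nonneg[OF assms] by (intro AE_cong) (auto simp: less_le)
  finally show ?thesis .
qed

lemma AE_density_pos:
  assumes "prob_density M f"
  shows "AE x in density M f. 0 < f x"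
  using prob_density_AE_nonneg[OF assms] by (auto simp: AE_density_prob_density[OF assms] less_le)

text \<open>A form that refers to the measure \<open>density M f\<close> alone, so that it can be
  transported along image measures.\<close>

lemma abs_cont_iff_AE_pos:
  assumes "prob_density M f" "prob_density M g"
  shows "abs_cont M f g \<longleftrightarrow> (AE x in density M f. 0 < g x)"
  unfolding abs_cont_iff[OF assms] AE_density_prob_density[OF assms(1)]
  using prob_density_nonneg[OF assms(2)] by (intro AE_cong) (auto simp: less_le)

text \<open>The quotient \<open>f / g\<close> is a density of \<open>density M f\<close> with
  respect to the probability measure \<open>density M g\<close>. Uniqueness of the Radon-Nikodym
  derivative identifies the two almost everywhere for \<open>g\<close>, and absolute continuity
  carries this over to \<open>f\<close>.\<close>

lemma entropy_density_eq_log_ratio: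
  assumes f: "prob_density M f" and g: "prob_density M g" and ac: "abs_cont M f g"
  shows "AE x in density M f. entropy_density b (density M g) (density M f) x = log b (f x / g x)"
proof -
  note [measurable] = prob_density_measurable[OF f] prob_density_measurable[OF g]
  interpret G: prob_space "density M g"
    by (rule prob_space_density_prob_density[OF g])
  have "density (density M g) (\<lambda>x. ennreal (f x / g x)) = density M f"
    using ac[unfolded abs_cont_iff[OF f g]] prob_density_AE_nonneg[OF f] prob_density_AE_nonneg[OF g]
    by (subst density_density_divide) auto
  then have "AE x in density M g. ennreal (f x / g x) = RN_deriv (density M g) (density M f) x"
    by (intro G.RN_deriv_unique) auto
  then have "AE x in density M f. ennreal (f x / g x) = RN_deriv (density M g) (density M f) x"
    using ac unfolding abs_cont_def
    by (intro absolutely_continuous_AE[where M="density M g" and M'="density M f"]) auto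
  with AE_density_pos[OF f] ac[unfolded abs_cont_iff_AE_pos[OF f g]] show ?thesis
  proof eventually_elim
    case (elim x)
    \<comment> \<open>Nonnegativity makes \<open>enn2real\<close>, which is part of
      \<open>entropy_density\<close>, undo \<open>ennreal\<close>.\<close>
    then have "0 \<le> f x / g x" by simp
    then show ?case by (simp add: entropy_density_def flip: elim(3))
  qed
qed

text \<open>Integration is against \<open>density M f\<close> rather than against \<open>M\<close>
  with weight \<open>f\<close>: a log ratio of marginals then depends on one coordinate only, and
  its integral can be pushed forward to that coordinate.\<close>

lemma
  assumes f: "prob_density M f" and g: "prob_density M g" and ac: "abs_cont M f g"
  shows KL_finite_iff: "KL_finite b M f g \<longleftrightarrow> integrable (density M f) (\<lambda>x. log b (f x / g x))"
    and KL_eq: "KL b M f g = (\<integral>x. log b (f x / g x) \<partial>density M f)"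
proof -
  note [measurable] = prob_density_measurable[OF f] prob_density_measurable[OF g]
  have 1: "entropy_density b (density M g) (density M f) \<in> borel_measurable (density M f)"
    unfolding entropy_density_def comp_def
    using borel_measurable_RN_deriv[of "density M g" "density M f"] by simp
  note 2 = entropy_density_eq_log_ratio[OF f g ac, of b]
  show "KL_finite b M f g \<longleftrightarrow> integrable (density M f) (\<lambda>x. log b (f x / g x))"
    unfolding KL_finite_def by (intro integrable_cong_AE 1 2) auto
  show "KL b M f g = (\<integral>x. log b (f x / g x) \<partial>density M f)"
    unfolding KL_def KL_divergence_def by (intro integral_cong_AE 1 2) auto
qed

lemma abs_cont_refl: "prob_density M f \<Longrightarrow> abs_cont M f f"
  by (simp add: abs_cont_iff)

lemma
  assumes f: "prob_density M f"
  shows KL_finite_refl: "KL_finite b M f f" and KL_refl: "KL b M f f = 0"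
proof -
  note ac = abs_cont_refl[OF f]
  note [measurable] = prob_density_measurable[OF f]
  have *: "AE x in density M f. log b (f x / f x) = 0"
    using AE_density_pos[OF f] by eventually_elim simp
  show "KL_finite b M f f"
    unfolding KL_finite_iff[OF f f ac] by (subst integrable_cong_AE[OF _ _ *]) auto
  show "KL b M f f = 0"
    unfolding KL_eq[OF f f ac] by (subst integral_cong_AE[OF _ _ *]) auto
qed

text \<open>Gibbs' inequality, with finiteness rewritten as integrability of the weighted log ratio
  over \<open>M\<close>.\<close>

lemma (in sigma_finite_measure) KL_nonneg:
  assumes "1 < b" and f: "prob_density M f" and g: "prob_density M g"
    and ac: "abs_cont M f g" and fin: "KL_finite b M f g"
  shows "0 \<le> KL b M f g"
proof -
  note [measurable] = prob_density_measurable[OF f] prob_density_measurable[OF g]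
  have "integrable M (\<lambda>x. f x * log b (f x / g x))"
    using fin[unfolded KL_finite_iff[OF f g ac]] prob_density_AE_nonneg[OF f]
    by (subst (asm) integrable_real_density) auto
  then show ?thesis
    unfolding KL_def using assms(1) ac[unfolded abs_cont_iff[OF f g]]
    by (intro KL_density_density_nonneg prob_space_density_prob_density prob_density_AE_nonneg f g)
       auto
qed

section \<open>Integrability of log ratios\<close>

text \<open>The inequality \<open>ln t \<le> t - 1\<close> at \<open>t = g x / f x\<close> bounds
  the negative part, weighted by \<open>f\<close>, by \<open>g / ln b\<close>, and \<open>g\<close>
  has integral 1.\<close>

lemma integrable_log_ratio_neg_part:
  assumes "1 < b" and f: "prob_density M f" and g: "prob_density M g"
  shows "integrable (density M f) (\<lambda>x. max 0 (- log b (f x / g x)))"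
proof -
  note [measurable] = prob_density_measurable[OF f] prob_density_measurable[OF g]
  have "integrable M (\<lambda>x. f x * max 0 (- log b (f x / g x)))"
  proof (rule Bochner_Integration.integrable_bound)
    show "integrable M (\<lambda>x. g x / ln b)"
      using prob_density_integrable[OF g] by simp
    show "AE x in M. norm (f x * max 0 (- log b (f x / g x))) \<le> norm (g x / ln b)"
      using prob_density_AE_nonneg[OF f] prob_density_AE_nonneg[OF g]
    proof eventually_elim
      case (elim x)
      show ?case
      proof (cases "f x = 0 \<or> g x = 0")
        case False
        with elim have pos: "0 < f x" "0 < g x" by auto
        have "f x * - log b (f x / g x) = f x * (ln (g x / f x) / ln b)"
          using pos by (simp add: log_def ln_div minus_divide_left)
        also have "\<dots> \<le> f x * ((g x / f x) / ln b)"
          using pos \<open>1 < b\<close> ln_le_minus_one[of "g x / f x"]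
          by (intro mult_left_mono divide_right_mono) auto
        also have "\<dots> = g x / ln b"
          using pos by simp
        finally show ?thesis
          using pos \<open>1 < b\<close> by (auto simp: max_def)
      \<comment> \<open>If \<open>g x = 0\<close>, the quotient is 0 by convention, and
        \<open>ln 0 = 0\<close> makes the left-hand side vanish.\<close>
      qed (use elim in \<open>auto simp: log_def\<close>)
    qed
  qed simp
  then show ?thesis
    using prob_density_AE_nonneg[OF f] by (subst integrable_real_density) auto
qed

text \<open>From \<open>A = (A + B) - B\<close> the positive part of \<open>A\<close> is at most
  \<open>\<bar>A + B\<bar>\<close> plus the negative part of \<open>B\<close>; the negative part of
  \<open>A\<close> is integrable by assumption.\<close>

lemma integrable_of_integrable_sum:
  fixes A B :: "'a \<Rightarrow> real"
  assumes [measurable]: "A \<in> borel_measurable P"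
    and sum: "integrable P (\<lambda>x. A x + B x)"
    and neg: "integrable P (\<lambda>x. max 0 (- A x))" "integrable P (\<lambda>x. max 0 (- B x))"
  shows "integrable P A"
proof (rule Bochner_Integration.integrable_bound)
  show "integrable P (\<lambda>x. \<bar>A x + B x\<bar> + max 0 (- A x) + max 0 (- B x))"
    using sum neg by auto
qed auto

text \<open>Only almost everywhere: where a section of \<open>f\<close> has infinite integral, the Bochner integrals
  defining \<^const>\<open>density_x\<close>, \<^const>\<open>density_y\<close> and \<^const>\<open>density_z\<close> are 0.\<close>

definition has_marginals ::
    "'a measure \<Rightarrow> 'b measure \<Rightarrow> ('a \<times> 'b \<Rightarrow> real) \<Rightarrow> ('a \<Rightarrow> real) \<Rightarrow> ('b \<Rightarrow> real) \<Rightarrow> bool" where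
  "has_marginals M N f f1 f2 \<longleftrightarrow>
     prob_density (M \<Otimes>\<^sub>M N) f \<and> prob_density M f1 \<and> prob_density N f2 \<and>
     (AE x in M. ennreal (f1 x) = (\<integral>\<^sup>+ y. f (x, y) \<partial>N)) \<and>
     (AE y in N. ennreal (f2 y) = (\<integral>\<^sup>+ x. f (x, y) \<partial>M))"

section \<open>Joint densities on a product space and their marginals\<close>

context pair_sigma_finite
begin

text \<open>Almost every section of an integrable function is integrable, so the Bochner integrals
  agree almost everywhere with the nonnegative ones, and Tonelli's theorem gives total mass
  1.\<close>

lemma has_marginals_density_xy:
  assumes f: "prob_density (M1 \<Otimes>\<^sub>M M2) f"
  shows "has_marginals M1 M2 f (density_x M2 f) (density_y M1 f)"
proof -
  note [measurable] = prob_density_measurable[OF f]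
  note nn = prob_density_nonneg[OF f]
  note int = prob_density_integrable[OF f]
  have 1: "AE x in M1. ennreal (density_x M2 f x) = (\<integral>\<^sup>+ y. f (x, y) \<partial>M2)"
    using AE_integrable_fst'[OF int] AE_space unfolding density_x_def
    by eventually_elim
       (use nn in \<open>auto simp: space_pair_measure intro!: nn_integral_eq_integral[symmetric]\<close>)
  have 2: "AE y in M2. ennreal (density_y M1 f y) = (\<integral>\<^sup>+ x. f (x, y) \<partial>M1)"
    using AE_integrable_snd[of "\<lambda>x y. f (x, y)"] int AE_space unfolding density_y_def
    by (auto elim!: eventually_elim2)
       (use nn in \<open>auto simp: space_pair_measure intro!: nn_integral_eq_integral[symmetric]\<close>)
  have "prob_density M1 (density_x M2 f)"
    unfolding prob_density_def
  proof (intro conjI ballI)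
    show "(\<integral>\<^sup>+ x. ennreal (density_x M2 f x) \<partial>M1) = 1"
      using prob_density_nn_integral[OF f]
      by (simp add: nn_integral_cong_AE[OF 1] M2.nn_integral_fst[where f="\<lambda>w. ennreal (f w)"])
  qed (use nn in \<open>auto simp: density_x_def space_pair_measure intro!: Bochner_Integration.integral_nonneg\<close>)
  moreover have "prob_density M2 (density_y M1 f)"
    unfolding prob_density_def
  proof (intro conjI ballI)
    show "(\<integral>\<^sup>+ x. ennreal (density_y M1 f x) \<partial>M2) = 1"
      using prob_density_nn_integral[OF f]
      by (simp add: nn_integral_cong_AE[OF 2] nn_integral_snd[where f="\<lambda>w. ennreal (f w)"])
  qed (use nn in \<open>auto simp: density_y_def space_pair_measure intro!: Bochner_Integration.integral_nonneg\<close>)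
  ultimately show ?thesis
    using f 1 2 by (simp add: has_marginals_def)
qed

text \<open>Makes results about general joint densities applicable to the product of the marginals
  itself.\<close>

lemma has_marginals_prod_density:
  assumes f: "prob_density M1 f" and g: "prob_density M2 g"
  shows "has_marginals M1 M2 (prod_density f g) f g"
proof -
  note [measurable] = prob_density_measurable[OF f] prob_density_measurable[OF g]
  have [measurable]: "prod_density f g \<in> borel_measurable (M1 \<Otimes>\<^sub>M M2)"
    unfolding prod_density_def by measurable
  have 1: "(\<integral>\<^sup>+ y. prod_density f g (x, y) \<partial>M2) = ennreal (f x)" if "x \<in> space M1" for x
    using prob_density_nonneg[OF f that] prob_density_nonneg[OF g] prob_density_nn_integral[OF g]
    by (simp add: prod_density_def ennreal_mult' nn_integral_cmult)
  have 2: "(\<integral>\<^sup>+ x. prod_density f g (x, y) \<partial>M1) = ennreal (g y)" if "y \<in> space M2" for y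
    using prob_density_nonneg[OF g that] prob_density_nonneg[OF f] prob_density_nn_integral[OF f]
    by (simp add: prod_density_def ennreal_mult'' nn_integral_multc)
  have "(\<integral>\<^sup>+ w. prod_density f g w \<partial>(M1 \<Otimes>\<^sub>M M2)) = (\<integral>\<^sup>+ x. \<integral>\<^sup>+ y. prod_density f g (x, y) \<partial>M2 \<partial>M1)"
    by (simp add: M2.nn_integral_fst[symmetric])
  also have "\<dots> = 1"
    using prob_density_nn_integral[OF f] by (simp add: 1 cong: nn_integral_cong)
  finally show ?thesis
    using f g prob_density_nonneg[OF f] prob_density_nonneg[OF g] 1 2
    by (auto simp: has_marginals_def prob_density_def space_pair_measure prod_density_def)
qed

lemma prob_density_prod_density:
  "prob_density M1 f \<Longrightarrow> prob_density M2 g \<Longrightarrow> prob_density (M1 \<Otimes>\<^sub>M M2) (prod_density f g)"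
  using has_marginals_prod_density by (simp add: has_marginals_def)

text \<open>Tonelli's theorem on cylinder sets. These equations move integrals and almost-everywhere
  statements about one coordinate between the joint measure and its marginals.\<close>

lemma
  assumes "has_marginals M1 M2 f f1 f2"
  shows distr_fst_density: "distr (density (M1 \<Otimes>\<^sub>M M2) f) M1 fst = density M1 f1"
    and distr_snd_density: "distr (density (M1 \<Otimes>\<^sub>M M2) f) M2 snd = density M2 f2"
proof -
  have f: "prob_density (M1 \<Otimes>\<^sub>M M2) f" "prob_density M1 f1" "prob_density M2 f2"
    and 1: "AE x in M1. ennreal (f1 x) = (\<integral>\<^sup>+ y. f (x, y) \<partial>M2)"
    and 2: "AE y in M2. ennreal (f2 y) = (\<integral>\<^sup>+ x. f (x, y) \<partial>M1)"
    using assms by (auto simp: has_marginals_def)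
  note [measurable] = f[THEN prob_density_measurable]
  show "distr (density (M1 \<Otimes>\<^sub>M M2) f) M1 fst = density M1 f1"
  proof (rule measure_eqI)
    fix A assume "A \<in> sets (distr (density (M1 \<Otimes>\<^sub>M M2) f) M1 fst)"
    then have A[measurable]: "A \<in> sets M1" by simp
    have "emeasure (distr (density (M1 \<Otimes>\<^sub>M M2) f) M1 fst) A =
        (\<integral>\<^sup>+ w. ennreal (f w) * indicator A (fst w) \<partial>(M1 \<Otimes>\<^sub>M M2))"
      by (simp add: emeasure_distr emeasure_density)
         (auto intro!: nn_integral_cong split: split_indicator)
    also have "\<dots> = (\<integral>\<^sup>+ x. (\<integral>\<^sup>+ y. f (x, y) \<partial>M2) * indicator A x \<partial>M1)"
      by (simp add: M2.nn_integral_fst[symmetric] nn_integral_multc cong: nn_integral_cong)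
    also have "\<dots> = (\<integral>\<^sup>+ x. ennreal (f1 x) * indicator A x \<partial>M1)"
      by (intro nn_integral_cong_AE) (use 1 in eventually_elim, simp)
    finally show "emeasure (distr (density (M1 \<Otimes>\<^sub>M M2) f) M1 fst) A = emeasure (density M1 f1) A"
      by (simp add: emeasure_density)
  qed simp
  show "distr (density (M1 \<Otimes>\<^sub>M M2) f) M2 snd = density M2 f2"
  proof (rule measure_eqI)
    fix A assume "A \<in> sets (distr (density (M1 \<Otimes>\<^sub>M M2) f) M2 snd)"
    then have A[measurable]: "A \<in> sets M2" by simp
    have "emeasure (distr (density (M1 \<Otimes>\<^sub>M M2) f) M2 snd) A =
        (\<integral>\<^sup>+ w. ennreal (f w) * indicator A (snd w) \<partial>(M1 \<Otimes>\<^sub>M M2))"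
      by (simp add: emeasure_distr emeasure_density)
         (auto intro!: nn_integral_cong split: split_indicator)
    also have "\<dots> = (\<integral>\<^sup>+ y. (\<integral>\<^sup>+ x. f (x, y) \<partial>M1) * indicator A y \<partial>M2)"
      by (simp add: nn_integral_snd[symmetric] nn_integral_multc cong: nn_integral_cong)
    also have "\<dots> = (\<integral>\<^sup>+ y. ennreal (f2 y) * indicator A y \<partial>M2)"
      by (intro nn_integral_cong_AE) (use 2 in eventually_elim, simp)
    finally show "emeasure (distr (density (M1 \<Otimes>\<^sub>M M2) f) M2 snd) A = emeasure (density M2 f2) A"
      by (simp add: emeasure_density)
  qed simp
qed

text \<open>A product of nonnegative factors is positive exactly when both are, and each factor sees
  only one coordinate. Hence the condition depends on \<open>f\<close> only through its marginals,
  and it is the same for \<open>f\<close> and for \<open>prod_density f1 f2\<close>.\<close>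

lemma abs_cont_prod_density_iff:
  assumes m: "has_marginals M1 M2 f f1 f2"
    and q: "prob_density M1 q" and r: "prob_density M2 r"
  shows "abs_cont (M1 \<Otimes>\<^sub>M M2) f (prod_density q r) \<longleftrightarrow> abs_cont M1 f1 q \<and> abs_cont M2 f2 r"
proof -
  have f: "prob_density (M1 \<Otimes>\<^sub>M M2) f" "prob_density M1 f1" "prob_density M2 f2"
    using m by (auto simp: has_marginals_def)
  note [measurable] = f[THEN prob_density_measurable] prob_density_measurable[OF q]
    prob_density_measurable[OF r]
  define P where "P = density (M1 \<Otimes>\<^sub>M M2) (\<lambda>w. ennreal (f w))"
  have [measurable_cong]: "sets P = sets (M1 \<Otimes>\<^sub>M M2)" by (simp add: P_def)
  have [simp]: "space P = space (M1 \<Otimes>\<^sub>M M2)" by (simp add: P_def)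
  have 1: "abs_cont M1 f1 q \<longleftrightarrow> (AE w in P. 0 < q (fst w))"
    unfolding abs_cont_iff_AE_pos[OF f(2) q] distr_fst_density[OF m, symmetric] P_def[symmetric]
    by (subst AE_distr_iff) auto
  have 2: "abs_cont M2 f2 r \<longleftrightarrow> (AE w in P. 0 < r (snd w))"
    unfolding abs_cont_iff_AE_pos[OF f(3) r] distr_snd_density[OF m, symmetric] P_def[symmetric]
    by (subst AE_distr_iff) auto
  have "abs_cont (M1 \<Otimes>\<^sub>M M2) f (prod_density q r) \<longleftrightarrow> (AE w in P. 0 < q (fst w) * r (snd w))"
    unfolding abs_cont_iff_AE_pos[OF f(1) prob_density_prod_density[OF q r]]
    unfolding P_def prod_density_def case_prod_beta' ..
  also have "\<dots> \<longleftrightarrow> (AE w in P. 0 < q (fst w) \<and> 0 < r (snd w))"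
    by (intro AE_cong)
       (use prob_density_nonneg[OF q] prob_density_nonneg[OF r] in
         \<open>force simp: space_pair_measure zero_less_mult_iff\<close>)
  finally show ?thesis by (simp add: 1 2)
qed

lemma abs_cont_marginals:
  assumes "has_marginals M1 M2 f f1 f2"
  shows "abs_cont (M1 \<Otimes>\<^sub>M M2) f (prod_density f1 f2)"
  using assms abs_cont_prod_density_iff[OF assms] by (auto simp: has_marginals_def abs_cont_refl)

section \<open>Splitting the divergence from a product density\<close>

text \<open>Stated with the two marginal divergences in place of the divergence of
  \<open>prod_density f1 f2\<close> from \<open>prod_density q r\<close>, so that it covers every
  admissible pair. That divergence is recovered by a second application, to
  \<open>prod_density f1 f2\<close> in the role of \<open>f\<close>.\<close>

lemma
  assumes b: "1 < b" and m: "has_marginals M1 M2 f f1 f2"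
    and q: "prob_density M1 q" and r: "prob_density M2 r"
    and ac: "abs_cont (M1 \<Otimes>\<^sub>M M2) f (prod_density q r)"
    and fin: "KL_finite b (M1 \<Otimes>\<^sub>M M2) f (prod_density f1 f2)"
      "KL_finite b (M1 \<Otimes>\<^sub>M M2) f (prod_density q r)"
  shows KL_finite_marginal_fst: "KL_finite b M1 f1 q"
    and KL_finite_marginal_snd: "KL_finite b M2 f2 r"
    and KL_prod_density_split: "KL b (M1 \<Otimes>\<^sub>M M2) f (prod_density q r) =
      KL b (M1 \<Otimes>\<^sub>M M2) f (prod_density f1 f2) + (KL b M1 f1 q + KL b M2 f2 r)"
proof -
  have f: "prob_density (M1 \<Otimes>\<^sub>M M2) f" "prob_density M1 f1" "prob_density M2 f2"
    using m by (auto simp: has_marginals_def)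
  have ac1: "abs_cont M1 f1 q" and ac2: "abs_cont M2 f2 r"
    using ac abs_cont_prod_density_iff[OF m q r] by auto
  note [measurable] = f[THEN prob_density_measurable] prob_density_measurable[OF q]
    prob_density_measurable[OF r]
  define P where "P = density (M1 \<Otimes>\<^sub>M M2) (\<lambda>w. ennreal (f w))"
  have [measurable_cong]: "sets P = sets (M1 \<Otimes>\<^sub>M M2)" by (simp add: P_def)
  note marg = distr_fst_density[OF m, folded P_def, symmetric]
    distr_snd_density[OF m, folded P_def, symmetric]
  define A where "A = (\<lambda>w::'a \<times> 'b. log b (f1 (fst w) / q (fst w)))"
  define B where "B = (\<lambda>w::'a \<times> 'b. log b (f2 (snd w) / r (snd w)))"
  define C where "C = (\<lambda>w. log b (f w / prod_density f1 f2 w))"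
  define D where "D = (\<lambda>w. log b (f w / prod_density q r w))"
  have [measurable]: "A \<in> borel_measurable P" "B \<in> borel_measurable P"
    unfolding A_def B_def by measurable
  note qr = prob_density_prod_density[OF q r] and f12 = prob_density_prod_density[OF f(2,3)]
  note ac12 = abs_cont_marginals[OF m]
  have C: "integrable P C" and D: "integrable P D"
    using fin KL_finite_iff[OF f(1) f12 ac12, of b] KL_finite_iff[OF f(1) qr ac, of b]
    by (auto simp: P_def C_def D_def)
  have AE1: "AE w in P. 0 < f1 (fst w)" "AE w in P. 0 < q (fst w)"
    using AE_density_pos[OF f(2)] ac1[unfolded abs_cont_iff_AE_pos[OF f(2) q]]
    unfolding marg by (auto dest!: AE_distrD[rotated])
  have AE2: "AE w in P. 0 < f2 (snd w)" "AE w in P. 0 < r (snd w)"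
    using AE_density_pos[OF f(3)] ac2[unfolded abs_cont_iff_AE_pos[OF f(3) r]]
    unfolding marg by (auto dest!: AE_distrD[rotated])
  have "AE w in P. 0 < f w"
    unfolding P_def by (rule AE_density_pos[OF f(1)])
  \<comment> \<open>All five densities involved are positive almost everywhere under
    \<open>P\<close>, as the logarithm laws for products and quotients require.\<close>
  with AE1 AE2 have sum: "AE w in P. A w + B w = D w - C w"
    by eventually_elim
       (use b in \<open>simp add: A_def B_def C_def D_def prod_density_def case_prod_beta' log_divide_pos log_mult_pos\<close>)
  have AB: "integrable P (\<lambda>w. A w + B w)"
    using C D by (subst integrable_cong_AE[OF _ _ sum]) auto
  have negA: "integrable P (\<lambda>w. max 0 (- A w))"
    using integrable_log_ratio_neg_part[OF b f(2) q] unfolding marg A_def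
    by (subst (asm) integrable_distr_eq) auto
  have negB: "integrable P (\<lambda>w. max 0 (- B w))"
    using integrable_log_ratio_neg_part[OF b f(3) r] unfolding marg B_def
    by (subst (asm) integrable_distr_eq) auto
  \<comment> \<open>Integrability of the sum alone would allow \<open>A\<close> and \<open>B\<close>
    to cancel; the integrable negative parts exclude this.\<close>
  have A: "integrable P A"
    using AB negA negB by (intro integrable_of_integrable_sum[of A P B]) auto
  have B: "integrable P B"
    using AB negA negB by (intro integrable_of_integrable_sum[of B P A]) (auto simp: add.commute)
  show "KL_finite b M1 f1 q"
    unfolding KL_finite_iff[OF f(2) q ac1] marg
    using A by (subst integrable_distr_eq) (auto simp: A_def)
  show "KL_finite b M2 f2 r"
    unfolding KL_finite_iff[OF f(3) r ac2] marg
    using B by (subst integrable_distr_eq) (auto simp: B_def)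
  have "KL b M1 f1 q = integral\<^sup>L P A"
    unfolding KL_eq[OF f(2) q ac1] marg A_def by (subst integral_distr) auto
  moreover have "KL b M2 f2 r = integral\<^sup>L P B"
    unfolding KL_eq[OF f(3) r ac2] marg B_def by (subst integral_distr) auto
  moreover have "(\<integral>w. A w + B w \<partial>P) = (\<integral>w. D w - C w \<partial>P)"
    using C D by (intro integral_cong_AE sum) auto
  then have "integral\<^sup>L P A + integral\<^sup>L P B = integral\<^sup>L P D - integral\<^sup>L P C"
    using A B C D by simp
  ultimately show "KL b (M1 \<Otimes>\<^sub>M M2) f (prod_density q r) =
      KL b (M1 \<Otimes>\<^sub>M M2) f (prod_density f1 f2) + (KL b M1 f1 q + KL b M2 f2 r)"
    by (simp add: KL_eq[OF f(1) f12 ac12] KL_eq[OF f(1) qr ac] P_def C_def D_def)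
qed

section \<open>The Pythagorean identity and minimality of the marginals\<close>

text \<open>The densities \<open>f\<close> and \<open>prod_density f1 f2\<close> have the same
  marginals, so splitting both divergences from \<open>prod_density q r\<close> yields the same two
  marginal terms. For the latter density the remaining term is its divergence from itself, which is
  0.\<close>

proposition KL_pythagoras:
  assumes b: "1 < b" and m: "has_marginals M1 M2 f f1 f2"
    and fin: "KL_finite b (M1 \<Otimes>\<^sub>M M2) f (prod_density f1 f2)"
    and adm: "admissible b M1 M2 f q r"
    and fin': "KL_finite b (M1 \<Otimes>\<^sub>M M2) (prod_density f1 f2) (prod_density q r)"
  shows "KL b (M1 \<Otimes>\<^sub>M M2) f (prod_density q r) =
      KL b (M1 \<Otimes>\<^sub>M M2) f (prod_density f1 f2) + KL b (M1 \<Otimes>\<^sub>M M2) (prod_density f1 f2) (prod_density q r)"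
    and "0 \<le> KL b (M1 \<Otimes>\<^sub>M M2) (prod_density f1 f2) (prod_density q r)"
proof -
  have f: "prob_density M1 f1" "prob_density M2 f2"
    using m by (auto simp: has_marginals_def)
  have q: "prob_density M1 q" and r: "prob_density M2 r"
    and ac: "abs_cont (M1 \<Otimes>\<^sub>M M2) f (prod_density q r)"
    and fin_qr: "KL_finite b (M1 \<Otimes>\<^sub>M M2) f (prod_density q r)"
    using adm by (auto simp: admissible_def)
  note f12 = prob_density_prod_density[OF f] and m12 = has_marginals_prod_density[OF f]
  have ac': "abs_cont (M1 \<Otimes>\<^sub>M M2) (prod_density f1 f2) (prod_density q r)"
    using ac abs_cont_prod_density_iff[OF m q r] abs_cont_prod_density_iff[OF m12 q r] by simp
  have "KL b (M1 \<Otimes>\<^sub>M M2) (prod_density f1 f2) (prod_density q r) = KL b M1 f1 q + KL b M2 f2 r"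
    using KL_prod_density_split[OF b m12 q r ac' KL_finite_refl[OF f12] fin'] KL_refl[OF f12]
    by simp
  then show "KL b (M1 \<Otimes>\<^sub>M M2) f (prod_density q r) =
      KL b (M1 \<Otimes>\<^sub>M M2) f (prod_density f1 f2) + KL b (M1 \<Otimes>\<^sub>M M2) (prod_density f1 f2) (prod_density q r)"
    using KL_prod_density_split[OF b m q r ac fin fin_qr] by simp
  show "0 \<le> KL b (M1 \<Otimes>\<^sub>M M2) (prod_density f1 f2) (prod_density q r)"
    by (rule P.KL_nonneg[OF b f12 prob_density_prod_density[OF q r] ac' fin'])
qed

text \<open>Obtained from the marginal divergences rather than from \<open>KL_pythagoras\<close>,
  because the finiteness condition \<open>fin'\<close> used there is not among the constraints in
  \<open>admissible\<close>.\<close>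

lemma KL_marginals_le:
  assumes b: "1 < b" and m: "has_marginals M1 M2 f f1 f2"
    and fin: "KL_finite b (M1 \<Otimes>\<^sub>M M2) f (prod_density f1 f2)"
    and adm: "admissible b M1 M2 f q r"
  shows "KL b (M1 \<Otimes>\<^sub>M M2) f (prod_density f1 f2) \<le> KL b (M1 \<Otimes>\<^sub>M M2) f (prod_density q r)"
proof -
  have f: "prob_density M1 f1" "prob_density M2 f2"
    using m by (auto simp: has_marginals_def)
  have q: "prob_density M1 q" and r: "prob_density M2 r"
    and ac: "abs_cont (M1 \<Otimes>\<^sub>M M2) f (prod_density q r)"
    and fin_qr: "KL_finite b (M1 \<Otimes>\<^sub>M M2) f (prod_density q r)"
    using adm by (auto simp: admissible_def)
  note split = b m q r ac fin fin_qr
  have "0 \<le> KL b M1 f1 q" "0 \<le> KL b M2 f2 r"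
    using abs_cont_prod_density_iff[OF m q r] ac b f q r
      KL_finite_marginal_fst[OF split] KL_finite_marginal_snd[OF split]
    by (auto intro!: M1.KL_nonneg M2.KL_nonneg)
  then show ?thesis
    using KL_prod_density_split[OF split] by simp
qed

lemma admissible_marginals:
  assumes m: "has_marginals M1 M2 f f1 f2"
    and fin: "KL_finite b (M1 \<Otimes>\<^sub>M M2) f (prod_density f1 f2)"
  shows "admissible b M1 M2 f f1 f2"
  using m fin abs_cont_marginals[OF m] by (auto simp: admissible_def has_marginals_def)

proposition is_arg_min_KL_marginals:
  assumes b: "1 < b" and m: "has_marginals M1 M2 f f1 f2"
    and fin: "KL_finite b (M1 \<Otimes>\<^sub>M M2) f (prod_density f1 f2)"
  shows "is_arg_min (\<lambda>(q, r). KL b (M1 \<Otimes>\<^sub>M M2) f (prod_density q r))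
    (\<lambda>(q, r). admissible b M1 M2 f q r) (f1, f2)"
  using admissible_marginals[OF m fin] KL_marginals_le[OF b m fin]
  by (auto simp: is_arg_min_linorder)

text \<open>\<open>LEAST\<close> over the reals is determined here because the lower bound is
  attained: the marginals themselves form an admissible pair.\<close>

proposition min_KL_eq_KL_marginals:
  assumes b: "1 < b" and m: "has_marginals M1 M2 f f1 f2"
    and fin: "KL_finite b (M1 \<Otimes>\<^sub>M M2) f (prod_density f1 f2)"
  shows "min_KL b M1 M2 f = KL b (M1 \<Otimes>\<^sub>M M2) f (prod_density f1 f2)"
  unfolding min_KL_def
  using admissible_marginals[OF m fin] KL_marginals_le[OF b m fin]
  by (intro Least_equality) auto

end

section \<open>Marginals of the densities induced by the encoder\<close>

text \<open>For each \<open>x\<close> the encoder integrates to 1 over \<open>z\<close>, which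
  leaves \<open>density_x MY p\<close>; the other marginal is \<open>density_z\<close> by unfolding
  its definition.\<close>

lemma has_marginals_xz:
  assumes sf: "sigma_finite_measure MX" "sigma_finite_measure MY" "sigma_finite_measure MZ"
    and p: "prob_density (MX \<Otimes>\<^sub>M MY) p" and e: "cond_density MX MZ e"
  shows "has_marginals MX MZ (density_xz MY p e) (density_x MY p) (density_z MX MY p e)"
proof -
  interpret XY: pair_sigma_finite MX MY using sf by (simp add: pair_sigma_finite_def)
  interpret XZ: pair_sigma_finite MX MZ using sf by (simp add: pair_sigma_finite_def)
  have pX: "prob_density MX (density_x MY p)"
    using XY.has_marginals_density_xy[OF p] by (simp add: has_marginals_def)
  note [measurable] = prob_density_measurable[OF pX]
  have [measurable]: "(\<lambda>w. e (fst w) (snd w)) \<in> borel_measurable (MX \<Otimes>\<^sub>M MZ)"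
    and e': "\<And>x. x \<in> space MX \<Longrightarrow> prob_density MZ (e x)"
    using e by (auto simp: cond_density_def case_prod_beta')
  have [measurable]: "density_xz MY p e \<in> borel_measurable (MX \<Otimes>\<^sub>M MZ)"
    unfolding density_xz_def case_prod_beta' by measurable
  have 1: "(\<integral>\<^sup>+ z. density_xz MY p e (x, z) \<partial>MZ) = ennreal (density_x MY p x)"
    if x: "x \<in> space MX" for x
    using prob_density_nonneg[OF pX x] prob_densityD[OF e'[OF x]]
    by (simp add: density_xz_def ennreal_mult' nn_integral_cmult)
  have "(\<integral>\<^sup>+ w. density_xz MY p e w \<partial>(MX \<Otimes>\<^sub>M MZ)) = (\<integral>\<^sup>+ x. \<integral>\<^sup>+ z. density_xz MY p e (x, z) \<partial>MZ \<partial>MX)"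
    by (simp add: XZ.M2.nn_integral_fst[symmetric])
  also have "\<dots> = 1"
    using prob_density_nn_integral[OF pX] by (simp add: 1 cong: nn_integral_cong)
  finally have "prob_density (MX \<Otimes>\<^sub>M MZ) (density_xz MY p e)"
    using prob_density_nonneg[OF pX] prob_density_nonneg[OF e']
    by (auto simp: prob_density_def density_xz_def space_pair_measure)
  from XZ.has_marginals_density_xy[OF this] show ?thesis
    using pX 1 by (auto simp: has_marginals_def density_y_def density_z_def density_xz_def)
qed

text \<open>All densities involved are marginals of the density of the triple (X, Y, Z), in which Z
  depends on Y only through X. Tonelli's theorem allows its coordinates to be integrated out in any
  order.\<close>

lemma has_marginals_yz:
  assumes sf: "sigma_finite_measure MX" "sigma_finite_measure MY" "sigma_finite_measure MZ"
    and p: "prob_density (MX \<Otimes>\<^sub>M MY) p" and e: "cond_density MX MZ e"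
  shows "has_marginals MY MZ (density_yz MX p e) (density_y MX p) (density_z MX MY p e)"
proof -
  interpret XY: pair_sigma_finite MX MY using sf by (simp add: pair_sigma_finite_def)
  interpret XZ: pair_sigma_finite MX MZ using sf by (simp add: pair_sigma_finite_def)
  interpret YZ: pair_sigma_finite MY MZ using sf by (simp add: pair_sigma_finite_def)
  interpret XYZ: pair_sigma_finite MX "MY \<Otimes>\<^sub>M MZ"
    using sf YZ.sigma_finite_measure_axioms by (simp add: pair_sigma_finite_def)
  note mp = XY.has_marginals_density_xy[OF p, unfolded has_marginals_def]
  note mxz = has_marginals_xz[OF sf p e, unfolded has_marginals_def]
  note [measurable] = prob_density_measurable[OF p]
  have [measurable]: "(\<lambda>w. e (fst w) (snd w)) \<in> borel_measurable (MX \<Otimes>\<^sub>M MZ)"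
    and e': "\<And>x. x \<in> space MX \<Longrightarrow> prob_density MZ (e x)"
    using e by (auto simp: cond_density_def case_prod_beta')
  have e_meas[measurable]: "e x \<in> borel_measurable MZ" if "x \<in> space MX" for x
    using prob_density_measurable[OF e'[OF that]] .
  \<comment> \<open>With \<open>x\<close> as the first coordinate and \<open>(y, z)\<close> as the
    second, \<open>density_yz\<close> is the second marginal of \<open>T\<close>, so the general
    result on marginals applies.\<close>
  define T where "T = (\<lambda>(x, y, z). p (x, y) * e x z)"
  have T_meas[measurable]: "T \<in> borel_measurable (MX \<Otimes>\<^sub>M (MY \<Otimes>\<^sub>M MZ))"
  proof -
    \<comment> \<open>The encoder is known to be measurable as a function of the pair
      \<open>(x, z)\<close>, hence the composition with the projection that drops
      \<open>y\<close>.\<close>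
    have "(\<lambda>w. (\<lambda>w. e (fst w) (snd w)) (fst w, snd (snd w))) \<in>
        borel_measurable (MX \<Otimes>\<^sub>M (MY \<Otimes>\<^sub>M MZ))"
      by measurable
    then show ?thesis
      unfolding T_def case_prod_beta' by simp
  qed
  have p_nn: "0 \<le> p (x, y)" if "x \<in> space MX" "y \<in> space MY" for x y
    using prob_density_nonneg[OF p] that by (auto simp: space_pair_measure)
  have e_nn: "0 \<le> e x z" if "x \<in> space MX" "z \<in> space MZ" for x z
    using prob_density_nonneg[OF e'] that by auto
  have T_z: "(\<integral>\<^sup>+ z. T (x, y, z) \<partial>MZ) = ennreal (p (x, y))" if "x \<in> space MX" "y \<in> space MY" for x y
    using p_nn[OF that] prob_densityD[OF e'[OF that(1)]]
    by (simp add: T_def ennreal_mult' nn_integral_cmult)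
  have T: "prob_density (MX \<Otimes>\<^sub>M (MY \<Otimes>\<^sub>M MZ)) T"
  proof -
    have "(\<integral>\<^sup>+ w. T w \<partial>(MX \<Otimes>\<^sub>M (MY \<Otimes>\<^sub>M MZ))) =
        (\<integral>\<^sup>+ x. \<integral>\<^sup>+ y. \<integral>\<^sup>+ z. T (x, y, z) \<partial>MZ \<partial>MY \<partial>MX)"
      by (simp add: YZ.P.nn_integral_fst[symmetric] XZ.M2.nn_integral_fst[symmetric] cong: nn_integral_cong)
    also have "\<dots> = (\<integral>\<^sup>+ x. \<integral>\<^sup>+ y. p (x, y) \<partial>MY \<partial>MX)"
      by (simp add: T_z cong: nn_integral_cong)
    also have "\<dots> = 1"
      using prob_density_nn_integral[OF p] by (simp add: XY.M2.nn_integral_fst[symmetric])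
    finally show ?thesis
      using p_nn e_nn T_meas unfolding prob_density_def
      by (auto simp: T_def space_pair_measure)
  qed
  have yz: "density_yz MX p e = density_y MX T"
    by (auto simp: density_yz_def density_y_def T_def)
  have pYZ: "prob_density (MY \<Otimes>\<^sub>M MZ) (density_yz MX p e)"
    and AE_yz: "AE w in MY \<Otimes>\<^sub>M MZ. ennreal (density_yz MX p e w) = (\<integral>\<^sup>+ x. T (x, w) \<partial>MX)"
    using XYZ.has_marginals_density_xy[OF T] by (auto simp: has_marginals_def yz)
  note [measurable] = prob_density_measurable[OF pYZ]
  have "AE y in MY. AE z in MZ. ennreal (density_yz MX p e (y, z)) = (\<integral>\<^sup>+ x. T (x, y, z) \<partial>MX)"
    using YZ.AE_pair[OF AE_yz] .
  moreover have "AE y in MY. ennreal (density_y MX p y) = (\<integral>\<^sup>+ x. p (x, y) \<partial>MX)"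
    using mp by simp
  ultimately have 1: "AE y in MY. ennreal (density_y MX p y) = (\<integral>\<^sup>+ z. density_yz MX p e (y, z) \<partial>MZ)"
    using AE_space
  proof eventually_elim
    case (elim y)
    note [measurable] = \<open>y \<in> space MY\<close>
    have "(\<integral>\<^sup>+ z. density_yz MX p e (y, z) \<partial>MZ) = (\<integral>\<^sup>+ z. \<integral>\<^sup>+ x. T (x, y, z) \<partial>MX \<partial>MZ)"
      using elim(1) by (rule nn_integral_cong_AE)
    \<comment> \<open>Integrating over \<open>z\<close> first removes the normalised
      encoder.\<close>
    also have "\<dots> = (\<integral>\<^sup>+ x. \<integral>\<^sup>+ z. T (x, y, z) \<partial>MZ \<partial>MX)"
      by (rule XZ.Fubini') measurable
    also have "\<dots> = (\<integral>\<^sup>+ x. p (x, y) \<partial>MX)"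
      using elim by (simp add: T_z cong: nn_integral_cong)
    finally show ?case using elim by simp
  qed
  \<comment> \<open>\<open>YZ.AE_pair\<close> yields the quantifiers with \<open>y\<close>
    outermost; fixing \<open>z\<close> first requires exchanging them.\<close>
  have "AE z in MZ. AE y in MY. ennreal (density_yz MX p e (y, z)) = (\<integral>\<^sup>+ x. T (x, y, z) \<partial>MX)"
    using YZ.AE_pair[OF AE_yz] by (subst YZ.AE_commute[symmetric]) auto
  moreover have "AE z in MZ. ennreal (density_z MX MY p e z) = (\<integral>\<^sup>+ x. density_xz MY p e (x, z) \<partial>MX)"
    using mxz by simp
  ultimately have 2: "AE z in MZ. ennreal (density_z MX MY p e z) = (\<integral>\<^sup>+ y. density_yz MX p e (y, z) \<partial>MY)"
    using AE_space
  proof eventually_elim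
    case (elim z)
    note [measurable] = \<open>z \<in> space MZ\<close>
    have "(\<integral>\<^sup>+ y. density_yz MX p e (y, z) \<partial>MY) = (\<integral>\<^sup>+ y. \<integral>\<^sup>+ x. T (x, y, z) \<partial>MX \<partial>MY)"
      using elim(1) by (rule nn_integral_cong_AE)
    also have "\<dots> = (\<integral>\<^sup>+ x. \<integral>\<^sup>+ y. T (x, y, z) \<partial>MY \<partial>MX)"
      by (rule XY.Fubini') measurable
    \<comment> \<open>The factor \<open>e x z\<close> is constant in \<open>y\<close>. The inner
      integral stays in \<open>ennreal\<close>, as it may be infinite on a null set of
      \<open>x\<close>; it is replaced by \<open>density_x MY p x\<close> only almost
      everywhere.\<close>
    also have "\<dots> = (\<integral>\<^sup>+ x. (\<integral>\<^sup>+ y. p (x, y) \<partial>MY) * ennreal (e x z) \<partial>MX)"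
      using e_nn elim
      by (intro nn_integral_cong) (simp add: T_def ennreal_mult'' nn_integral_multc)
    also have "\<dots> = (\<integral>\<^sup>+ x. density_xz MY p e (x, z) \<partial>MX)"
    proof (rule nn_integral_cong_AE)
      have "AE x in MX. ennreal (density_x MY p x) = (\<integral>\<^sup>+ y. p (x, y) \<partial>MY)"
        using mp by simp
      then show "AE x in MX. (\<integral>\<^sup>+ y. p (x, y) \<partial>MY) * ennreal (e x z) = ennreal (density_xz MY p e (x, z))"
        using AE_space
        by eventually_elim (use e_nn elim in \<open>simp add: density_xz_def ennreal_mult''\<close>)
    qed
    finally show ?case using elim by simp
  qed
  show ?thesis
    using mp mxz pYZ 1 2 by (simp add: has_marginals_def)
qed

section \<open>The mutual informations and the Information Bottleneck loss\<close>

theorem mainTheorem1: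
  fixes MX :: "'x measure" and MY :: "'y measure" and MZ :: "'z measure"
    and p :: "'x \<times> 'y \<Rightarrow> real"
    and enc :: "'p \<Rightarrow> 'x \<Rightarrow> 'z \<Rightarrow> real" and \<phi> :: 'p
    and b \<beta> :: real
  assumes "sigma_finite_measure MX" "sigma_finite_measure MY" "sigma_finite_measure MZ"
    and "1 < b" and "0 \<le> \<beta>"
    and "prob_density (MX \<Otimes>\<^sub>M MY) p"
    and "cond_density MX MZ (enc \<phi>)"
    and "KL_finite b (MX \<Otimes>\<^sub>M MZ) (density_xz MY p (enc \<phi>))
           (prod_density (density_x MY p) (density_z MX MY p (enc \<phi>)))"
    and "KL_finite b (MY \<Otimes>\<^sub>M MZ) (density_yz MX p (enc \<phi>))
           (prod_density (density_y MX p) (density_z MX MY p (enc \<phi>)))"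
  shows
    "let pX = density_x MY p;
         pY = density_y MX p;
         pZ = density_z MX MY p (enc \<phi>);
         pXZ = density_xz MY p (enc \<phi>);
         pYZ = density_yz MX p (enc \<phi>);
         XZ = MX \<Otimes>\<^sub>M MZ;
         YZ = MY \<Otimes>\<^sub>M MZ
     in
       ((\<forall>q r. admissible b MX MZ pXZ q r \<and>
               KL_finite b XZ (prod_density pX pZ) (prod_density q r) \<longrightarrow>
           KL b XZ pXZ (prod_density q r) =
             KL b XZ pXZ (prod_density pX pZ) + KL b XZ (prod_density pX pZ) (prod_density q r) \<and>
           0 \<le> KL b XZ (prod_density pX pZ) (prod_density q r)) \<and>
        KL b XZ pXZ (prod_density pX pZ) = I_ZX b MX MY MZ p (enc \<phi>) \<and>
        I_ZX b MX MY MZ p (enc \<phi>) = min_KL b MX MZ pXZ \<and>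
        is_arg_min (\<lambda>(q, r). KL b XZ pXZ (prod_density q r))
          (\<lambda>(q, r). admissible b MX MZ pXZ q r) (pX, pZ)) \<and>
       ((\<forall>q' r'. admissible b MY MZ pYZ q' r' \<and>
               KL_finite b YZ (prod_density pY pZ) (prod_density q' r') \<longrightarrow>
           KL b YZ pYZ (prod_density q' r') =
             I_ZY b MX MY MZ p (enc \<phi>) + KL b YZ (prod_density pY pZ) (prod_density q' r')) \<and>
        I_ZY b MX MY MZ p (enc \<phi>) = min_KL b MY MZ pYZ \<and>
        is_arg_min (\<lambda>(q', r'). KL b YZ pYZ (prod_density q' r'))
          (\<lambda>(q', r'). admissible b MY MZ pYZ q' r') (pY, pZ)) \<and>
       IB_loss b \<beta> MX MY MZ p (enc \<phi>) = \<beta> * min_KL b MX MZ pXZ - min_KL b MY MZ pYZ"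
proof -
  interpret XZ: pair_sigma_finite MX MZ using assms by (simp add: pair_sigma_finite_def)
  interpret YZ: pair_sigma_finite MY MZ using assms by (simp add: pair_sigma_finite_def)
  note xz = \<open>1 < b\<close> has_marginals_xz[OF assms(1-3,6,7)] assms(8)
  note yz = \<open>1 < b\<close> has_marginals_yz[OF assms(1-3,6,7)] assms(9)
  show ?thesis
    unfolding Let_def IB_loss_def I_ZX_def I_ZY_def
    using XZ.KL_pythagoras[OF xz] XZ.is_arg_min_KL_marginals[OF xz] XZ.min_KL_eq_KL_marginals[OF xz]
      YZ.KL_pythagoras[OF yz] YZ.is_arg_min_KL_marginals[OF yz] YZ.min_KL_eq_KL_marginals[OF yz]
    by auto
qed

end
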